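(* Let $\mathcal B$ be a basis of a real Banach space $\mathbb X$ and let $w$ be a weight. If $\mathcal B$ is $C_s$-$w$-superdemocratic and satisfies the Property (C) with constant $C_u$, then $\mathcal B$ has the $C_a$-$w$-Property (A) with $C_a\le 3C_uC_s$.
   Context: Basis: a Schauder basis $\mathcal B=(e_n)_{n=1}^\infty$ of a real Banach space $\mathbb X$ with biorthogonal functionals $(e_n^* )_{n=1}^\infty$ such that $0<\inf_n\min\{\|e_n\|,\|e_n^*\|\}\le\sup_n\max\{\|e_n\|,\|e_n^*\|\}<\infty$. For $x\in\mathbb X$, $\mathrm{supp}(x)=\{i\in\mathbb N: e_i^*(x)\neq0\}$. $\mathbb N^{<\infty}$ is the family of finite subsets of $\mathbb N$. For signs $\varepsilon=(\varepsilon_n)$, $\varepsilon_n\in\{\pm1\}$, and finite $A$, $\mathbf 1_{\varepsilon A}=\sum_{n\in A}\varepsilon_ne_n$. A weight is a sequence $w=(w_i)_{i=1}^\infty\in(0,\infty)^{\mathbb N}$; $w(A)=\sum_{i\in A}w_i$. A greedy set of $x$ is a nonempty finite set $\Lambda\subset\mathrm{supp}(x)$ with $\min_{k\in\Lambda}|e_k^*(x)|\ge\sup_{k\notin\Lambda}|e_k^*(x)|$. $\mathcal B$ is $w$-superdemocratic if there is $C\ge1$ with $\|\mathbf 1_{\varepsilon A}\|\le C\|\mathbf 1_{\eta B}\|$ for all $A,B\in\mathbb N^{<\infty}$ with $w(A)\le w(B)$ and all signs $\varepsilon,\eta$; the least such $C$ is $C_s$ and $\mathcal B$ is then called $C_s$-$w$-superdemocratic.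 $\mathcal B$ satisfies the Property (C) if there is a constant $C>0$ with $\min_{j\in\Lambda}|e_j^*(x)|\,\|\mathbf 1_{\varepsilon\Lambda}\|\le C\|x\|$ for all $x\in\mathbb X$, every greedy set $\Lambda$ of $x$ and all signs $\varepsilon$; the least such $C$ is $C_u$. $\mathcal B$ has the $w$-Property (A) if there is $C\ge1$ such that $\|x+t\mathbf 1_{\varepsilon A}\|\le C\|x+t\mathbf 1_{\eta B}\|$ for all $x\in\mathbb X$, all $A,B\in\mathbb N^{<\infty}$ with $w(A)\le w(B)$, $A\cap B=\emptyset$, $\mathrm{supp}(x)\cap(A\cup B)=\emptyset$, all signs $\varepsilon,\eta$, and all $t\ge\sup_j|e_j^*(x)|$; the least such $C$ is $C_a$ and $\mathcal B$ is then said to have the $C_a$-$w$-Property (A). *)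

theory Defs
  imports "HOL-Analysis.Analysis"
begin

text \<open>
  Basis vectors, functionals, signs and weights are indexed by \<open>nat\<close>, that is, by
  \<open>0, 1, 2, \<dots>\<close> instead of \<open>1, 2, 3, \<dots>\<close>; a bare \<open>'a::banach\<close> is a real Banach space, and
  \<open>'a \<Rightarrow>\<^sub>L real\<close>, with its operator norm, is the dual space.
\<close>

definition schauder_basis :: "(nat \<Rightarrow> 'a::banach) \<Rightarrow> bool" where
  "schauder_basis e \<longleftrightarrow> (\<forall>x. \<exists>!a :: nat \<Rightarrow> real. (\<lambda>n. a n *\<^sub>R e n) sums x)"

definition biorthogonal :: "(nat \<Rightarrow> 'a::banach) \<Rightarrow> (nat \<Rightarrow> 'a \<Rightarrow>\<^sub>L real) \<Rightarrow> bool" where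
  "biorthogonal e e' \<longleftrightarrow> (\<forall>m n. e' m (e n) = (if m = n then 1 else 0))"

text \<open>
  For a Schauder basis \<open>e\<close> the functionals \<open>e'\<close> are determined by biorthogonality.
  The infimum is over a family bounded below by 0, hence genuine; finiteness
  of the supremum is expressed by \<^const>\<open>bdd_above\<close>.
\<close>

definition is_basis :: "(nat \<Rightarrow> 'a::banach) \<Rightarrow> (nat \<Rightarrow> 'a \<Rightarrow>\<^sub>L real) \<Rightarrow> bool" where
  "is_basis e e' \<longleftrightarrow> schauder_basis e \<and> biorthogonal e e'
     \<and> 0 < (INF n. min (norm (e n)) (norm (e' n)))
     \<and> bdd_above (range (\<lambda>n. max (norm (e n)) (norm (e' n))))"

definition basis_supp :: "(nat \<Rightarrow> 'a::banach \<Rightarrow>\<^sub>L real) \<Rightarrow> 'a \<Rightarrow> nat set" where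
  "basis_supp e' x = {i. e' i x \<noteq> 0}"

definition signs :: "(nat \<Rightarrow> real) set" where
  "signs = {\<epsilon>. \<forall>n. \<epsilon> n \<in> {-1, 1}}"

definition signed_ind :: "(nat \<Rightarrow> 'a::banach) \<Rightarrow> (nat \<Rightarrow> real) \<Rightarrow> nat set \<Rightarrow> 'a" where
  "signed_ind e \<epsilon> A = (\<Sum>n\<in>A. \<epsilon> n *\<^sub>R e n)"

definition is_weight :: "(nat \<Rightarrow> real) \<Rightarrow> bool" where
  "is_weight w \<longleftrightarrow> (\<forall>i. 0 < w i)"

definition weight_of :: "(nat \<Rightarrow> real) \<Rightarrow> nat set \<Rightarrow> real" where
  "weight_of w A = (\<Sum>i\<in>A. w i)"

text \<open>
  For \<open>is_basis e e'\<close> the coefficients of \<open>x\<close> are bounded, so the real-valued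
  suprema below are genuine.
\<close>

definition greedy_set :: "(nat \<Rightarrow> 'a::banach \<Rightarrow>\<^sub>L real) \<Rightarrow> 'a \<Rightarrow> nat set \<Rightarrow> bool" where
  "greedy_set e' x \<Lambda> \<longleftrightarrow> finite \<Lambda> \<and> \<Lambda> \<noteq> {} \<and> \<Lambda> \<subseteq> basis_supp e' x
     \<and> Min ((\<lambda>k. \<bar>e' k x\<bar>) ` \<Lambda>) \<ge> (SUP k\<in>-\<Lambda>. \<bar>e' k x\<bar>)"

definition superdemocratic_with :: "(nat \<Rightarrow> 'a::banach) \<Rightarrow> (nat \<Rightarrow> real) \<Rightarrow> real \<Rightarrow> bool" where
  "superdemocratic_with e w C \<longleftrightarrow> C \<ge> 1 \<and>
     (\<forall>A B. finite A \<longrightarrow> finite B \<longrightarrow> weight_of w A \<le> weight_of w B \<longrightarrow>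
        (\<forall>\<epsilon>\<in>signs. \<forall>\<eta>\<in>signs. norm (signed_ind e \<epsilon> A) \<le> C * norm (signed_ind e \<eta> B)))"

definition superdemocratic :: "(nat \<Rightarrow> 'a::banach) \<Rightarrow> (nat \<Rightarrow> real) \<Rightarrow> bool" where
  "superdemocratic e w \<longleftrightarrow> (\<exists>C. superdemocratic_with e w C)"

definition superdemocracy_const :: "(nat \<Rightarrow> 'a::banach) \<Rightarrow> (nat \<Rightarrow> real) \<Rightarrow> real" where
  "superdemocracy_const e w = (LEAST C. superdemocratic_with e w C)"

definition property_C_with ::
    "(nat \<Rightarrow> 'a::banach) \<Rightarrow> (nat \<Rightarrow> 'a \<Rightarrow>\<^sub>L real) \<Rightarrow> real \<Rightarrow> bool" where
  "property_C_with e e' C \<longleftrightarrow> C > 0 \<and>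
     (\<forall>x \<Lambda>. greedy_set e' x \<Lambda> \<longrightarrow>
        (\<forall>\<epsilon>\<in>signs. Min ((\<lambda>j. \<bar>e' j x\<bar>) ` \<Lambda>) * norm (signed_ind e \<epsilon> \<Lambda>) \<le> C * norm x))"

definition property_C :: "(nat \<Rightarrow> 'a::banach) \<Rightarrow> (nat \<Rightarrow> 'a \<Rightarrow>\<^sub>L real) \<Rightarrow> bool" where
  "property_C e e' \<longleftrightarrow> (\<exists>C. property_C_with e e' C)"

definition property_C_const :: "(nat \<Rightarrow> 'a::banach) \<Rightarrow> (nat \<Rightarrow> 'a \<Rightarrow>\<^sub>L real) \<Rightarrow> real" where
  "property_C_const e e' = (LEAST C. property_C_with e e' C)"

definition property_A_with ::
    "(nat \<Rightarrow> 'a::banach) \<Rightarrow> (nat \<Rightarrow> 'a \<Rightarrow>\<^sub>L real) \<Rightarrow> (nat \<Rightarrow> real) \<Rightarrow> real \<Rightarrow> bool" where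
  "property_A_with e e' w C \<longleftrightarrow> C \<ge> 1 \<and>
     (\<forall>x A B. finite A \<longrightarrow> finite B \<longrightarrow> weight_of w A \<le> weight_of w B \<longrightarrow> A \<inter> B = {} \<longrightarrow>
        basis_supp e' x \<inter> (A \<union> B) = {} \<longrightarrow>
        (\<forall>\<epsilon>\<in>signs. \<forall>\<eta>\<in>signs. \<forall>t. t \<ge> (SUP j. \<bar>e' j x\<bar>) \<longrightarrow>
           norm (x + t *\<^sub>R signed_ind e \<epsilon> A) \<le> C * norm (x + t *\<^sub>R signed_ind e \<eta> B)))"

definition property_A ::
    "(nat \<Rightarrow> 'a::banach) \<Rightarrow> (nat \<Rightarrow> 'a \<Rightarrow>\<^sub>L real) \<Rightarrow> (nat \<Rightarrow> real) \<Rightarrow> bool" where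
  "property_A e e' w \<longleftrightarrow> (\<exists>C. property_A_with e e' w C)"

definition property_A_const ::
    "(nat \<Rightarrow> 'a::banach) \<Rightarrow> (nat \<Rightarrow> 'a \<Rightarrow>\<^sub>L real) \<Rightarrow> (nat \<Rightarrow> real) \<Rightarrow> real" where
  "property_A_const e e' w = (LEAST C. property_A_with e e' w C)"

text \<open>
  The \<open>LEAST\<close> constants above are attained: each condition on \<open>C\<close> is preserved under
  infima of nonempty sets. (For property (C), strict positivity survives because taking
  \<open>x\<close> to be a basis vector forces \<open>C \<ge> 1\<close>.)
\<close>

end

theory Submission
  imports Defs
begin

text \<open>
  Put \<open>y = x + t 1\<^bsub>\<eta>B\<^esub>\<close>. Since \<open>x\<close> vanishes on \<open>B\<close> and its coefficients are at most \<open>t\<close>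
  in modulus, the set \<open>B\<close> is a greedy set of \<open>y\<close> whose coefficients all have modulus \<open>t\<close>, provided
  \<open>t > 0\<close> and \<open>B \<noteq> {}\<close> (lemma \<open>greedy_set_add_signed_ind\<close>). Property (C) then gives
  \<open>t \<parallel>1\<^bsub>\<eta>B\<^esub>\<parallel> \<le> C\<^sub>u \<parallel>y\<parallel>\<close>, and superdemocracy gives \<open>t \<parallel>1\<^bsub>\<epsilon>A\<^esub>\<parallel> \<le> C\<^sub>s C\<^sub>u \<parallel>y\<parallel>\<close>. Replacing the
  \<open>B\<close>-part of \<open>y\<close> by the \<open>A\<close>-part therefore costs, by the triangle inequality, at most a factor
  \<open>1 + C\<^sub>u + C\<^sub>s C\<^sub>u \<le> 3 C\<^sub>u C\<^sub>s\<close>, where \<open>C\<^sub>u \<ge> 1\<close> is seen by testing Property (C) on a basis vector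
  (lemma \<open>property_A_with_superdemocratic_property_C\<close>).

  This works for any two admissible constants. Each of the three defining conditions cuts out a
  closed set of constants that is bounded below by 1, so the least constants exist and the
  estimate applies to them (lemma \<open>LEAST_real_closed\<close>).
\<close>

lemma LEAST_real_closed:
  fixes P :: "real \<Rightarrow> bool"
  assumes "closed {C. P C}" and "\<And>C. P C \<Longrightarrow> b \<le> C" and "P C\<^sub>0"
  shows "P (LEAST C. P C)" and "(LEAST C. P C) \<le> C\<^sub>0"
proof -
  have bdd: "bdd_below {C. P C}"
    using assms(2) unfolding bdd_below_def by blast
  have "Inf {C. P C} \<in> {C. P C}"
    using assms(1,3) bdd by (intro closed_contains_Inf) auto
  moreover have low: "Inf {C. P C} \<le> C" if "P C" for C
    using that bdd by (auto intro: cInf_lower)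
  ultimately have "(LEAST C. P C) = Inf {C. P C}"
    by (intro Least_equality) auto
  with \<open>Inf {C. P C} \<in> {C. P C}\<close> low[OF assms(3)]
  show "P (LEAST C. P C)" and "(LEAST C. P C) \<le> C\<^sub>0"
    by auto
qed

lemma closed_superdemocratic_with: "closed {C. superdemocratic_with e w C}"
  unfolding superdemocratic_with_def Ball_def
  by (intro closed_Collect_conj closed_Collect_all closed_Collect_imp open_Collect_const
      closed_Collect_le continuous_intros)

lemma closed_property_A_with: "closed {C. property_A_with e e' w C}"
  unfolding property_A_with_def Ball_def
  by (intro closed_Collect_conj closed_Collect_all closed_Collect_imp open_Collect_const
      closed_Collect_le continuous_intros)

lemma greedy_set_basis_vector:
  assumes "biorthogonal e e'"
  shows "greedy_set e' (e n) {n}"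
proof -
  have coeff: "blinfun_apply (e' m) (e n) = (if m = n then 1 else 0)" for m
    using assms by (auto simp: biorthogonal_def)
  have "(SUP k\<in>-{n}. \<bar>e' k (e n)\<bar>) \<le> 1"
  proof (rule cSUP_least)
    show "- {n} \<noteq> {}"
      using finite_compl[of "{n}"] by (metis finite.emptyI finite.insertI infinite_UNIV_nat)
  qed (simp add: coeff)
  then show ?thesis
    by (simp add: greedy_set_def basis_supp_def coeff)
qed

lemma property_C_with_ge_1:
  assumes "biorthogonal e e'" and "property_C_with e e' C"
  shows "1 \<le> C"
proof -
  have coeff: "e' 0 (e 0) = 1"
    using assms(1) by (simp add: biorthogonal_def)
  have one: "(\<lambda>_. 1) \<in> signs"
    by (simp add: signs_def)
  have "Min ((\<lambda>j. \<bar>e' j (e 0)\<bar>) ` {0}) * norm (signed_ind e (\<lambda>_. 1) {0}) \<le> C * norm (e 0)"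
    using assms(2) greedy_set_basis_vector[OF assms(1), of 0]
    unfolding property_C_with_def by (blast intro: one)
  then have "1 * norm (e 0) \<le> C * norm (e 0)"
    by (simp add: signed_ind_def coeff)
  moreover have "e 0 \<noteq> 0"
    using coeff by auto
  ultimately show ?thesis
    by simp
qed

text \<open>
  The requirement \<open>0 < C\<close> alone is not closed; it is the automatic bound \<open>1 \<le> C\<close> that makes the
  set of admissible constants closed.
\<close>

lemma closed_property_C_with:
  assumes "biorthogonal e e'"
  shows "closed {C. property_C_with e e' C}"
proof -
  have "{C. property_C_with e e' C} = {C. 1 \<le> C \<and> (\<forall>x \<Lambda>. greedy_set e' x \<Lambda> \<longrightarrow> (\<forall>\<epsilon>\<in>signs.
      Min ((\<lambda>j. \<bar>e' j x\<bar>) ` \<Lambda>) * norm (signed_ind e \<epsilon> \<Lambda>) \<le> C * norm x))}"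
    using property_C_with_ge_1[OF assms] by (force simp: property_C_with_def)
  also have "closed \<dots>"
    unfolding Ball_def
    by (intro closed_Collect_conj closed_Collect_all closed_Collect_imp open_Collect_const
        closed_Collect_le continuous_intros)
  finally show ?thesis .
qed

lemma biorthogonal_signed_ind:
  assumes "biorthogonal e e'" and "finite B"
  shows "e' k (signed_ind e \<eta> B) = (if k \<in> B then \<eta> k else 0)"
proof -
  have "e' k (signed_ind e \<eta> B) = (\<Sum>n\<in>B. if n = k then \<eta> n else 0)"
    using assms(1)
    by (auto simp: signed_ind_def blinfun.sum_right blinfun.scaleR_right biorthogonal_def
        intro!: sum.cong)
  then show ?thesis
    using assms(2) by simp
qed

text \<open>
  A supremum of reals bounds the individual terms only if they are bounded above; here they are,
  by \<open>\<bar>e\<^sub>n\<^sup>*(x)\<bar> \<le> \<parallel>e\<^sub>n\<^sup>*\<parallel> \<parallel>x\<parallel>\<close> and the uniform bound on \<open>\<parallel>e\<^sub>n\<^sup>*\<parallel>\<close>.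
\<close>

lemma coefficient_le_SUP:
  assumes "is_basis e e'"
  shows "\<bar>e' k x\<bar> \<le> (SUP j. \<bar>e' j x\<bar>)"
proof -
  obtain M where "\<And>n. max (norm (e n)) (norm (e' n)) \<le> M"
    using assms by (auto simp: is_basis_def bdd_above_def)
  then have M: "norm (e' n) \<le> M" for n
    by (meson max.bounded_iff)
  have "\<bar>e' n x\<bar> \<le> M * norm x" for n
    using norm_blinfun[of "e' n" x] mult_right_mono[OF M[of n] norm_ge_zero[of x]] by simp
  then have "bdd_above (range (\<lambda>j. \<bar>e' j x\<bar>))"
    unfolding bdd_above_def by blast
  then show ?thesis
    by (rule cSUP_upper[OF UNIV_I])
qed

lemma greedy_set_add_signed_ind:
  assumes bi: "biorthogonal e e'" and B: "finite B" "B \<noteq> {}" and \<eta>: "\<eta> \<in> signs"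
    and disj: "basis_supp e' x \<inter> B = {}" and t: "0 < t" "\<And>k. \<bar>e' k x\<bar> \<le> t"
  shows "greedy_set e' (x + t *\<^sub>R signed_ind e \<eta> B) B"
    and "Min ((\<lambda>k. \<bar>e' k (x + t *\<^sub>R signed_ind e \<eta> B)\<bar>) ` B) = t"
proof -
  let ?y = "x + t *\<^sub>R signed_ind e \<eta> B"
  have coeff: "e' k ?y = e' k x + t * (if k \<in> B then \<eta> k else 0)" for k
    by (simp add: blinfun.add_right blinfun.scaleR_right biorthogonal_signed_ind[OF bi B(1)])
  have on: "\<bar>e' k ?y\<bar> = t" if "k \<in> B" for k
  proof -
    have "e' k x = 0"
      using that disj by (auto simp: basis_supp_def)
    moreover have "\<bar>\<eta> k\<bar> = 1"
      using \<eta> unfolding signs_def by (auto dest!: spec[of _ k])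
    ultimately show ?thesis
      using that t(1) by (simp add: coeff abs_mult)
  qed
  then have "(\<lambda>k. \<bar>e' k ?y\<bar>) ` B = {t}"
    using B(2) by force
  then show Min: "Min ((\<lambda>k. \<bar>e' k ?y\<bar>) ` B) = t"
    by simp
  have "- B \<noteq> {}"
    using B(1) by (metis Compl_eq_Diff_UNIV Diff_eq_empty_iff finite_subset infinite_UNIV_nat)
  then have "(SUP k\<in>-B. \<bar>e' k ?y\<bar>) \<le> t"
    by (rule cSUP_least) (use t(2) in \<open>simp add: coeff\<close>)
  moreover have "B \<subseteq> basis_supp e' ?y"
    using on t(1) by (force simp: basis_supp_def)
  ultimately show "greedy_set e' ?y B"
    using B Min by (simp add: greedy_set_def)
qed

lemma property_A_with_superdemocratic_property_C:
  assumes basis: "is_basis e e'" and w: "is_weight w"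
    and sd: "superdemocratic_with e w D" and pC: "property_C_with e e' C"
  shows "property_A_with e e' w (3 * C * D)"
proof -
  have bi: "biorthogonal e e'"
    using basis by (simp add: is_basis_def)
  have "1 \<le> C" and "1 \<le> D"
    using property_C_with_ge_1[OF bi pC] sd by (auto simp: superdemocratic_with_def)
  then have CD: "1 \<le> C * D" "C \<le> C * D"
    using mult_mono[of 1 C 1 D] mult_left_mono[of 1 D C] by auto
  have "norm (x + t *\<^sub>R signed_ind e \<epsilon> A) \<le> 3 * C * D * norm (x + t *\<^sub>R signed_ind e \<eta> B)"
    (is "norm ?z \<le> _ * norm ?y")
    if fin: "finite A" "finite B" and le: "weight_of w A \<le> weight_of w B"
      and disj: "basis_supp e' x \<inter> (A \<union> B) = {}"
      and sgn: "\<epsilon> \<in> signs" "\<eta> \<in> signs" and t: "(SUP j. \<bar>e' j x\<bar>) \<le> t"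
    for x A B \<epsilon> \<eta> t
  proof (cases "t = 0 \<or> B = {}")
    case True
    \<comment> \<open>Here \<open>B\<close> is not a greedy set. If \<open>B = {}\<close>, positivity of the weight forces \<open>A = {}\<close>, so
      in both cases the two vectors agree.\<close>
    have "A = {}" if "B = {}"
    proof (rule ccontr)
      assume "A \<noteq> {}"
      then have "0 < weight_of w A"
        using w fin(1) unfolding weight_of_def is_weight_def by (intro sum_pos) auto
      with le that show False
        by (simp add: weight_of_def)
    qed
    with True have "?z = ?y"
      by (auto simp: signed_ind_def)
    moreover have "norm ?y \<le> 3 * C * D * norm ?y"
      using mult_right_mono[of 1 "3 * C * D" "norm ?y"] CD(1) by simp
    ultimately show ?thesis
      by (simp only:)
  next
    case False
    have bound: "\<bar>e' k x\<bar> \<le> t" for k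
      using coefficient_le_SUP[OF basis] t by (rule order_trans)
    have "0 < t"
      using bound[of 0] abs_ge_zero[of "e' 0 x"] False by linarith
    have disj': "basis_supp e' x \<inter> B = {}"
      using disj by auto
    have "B \<noteq> {}"
      using False by simp
    note greedy = greedy_set_add_signed_ind[OF bi fin(2) \<open>B \<noteq> {}\<close> sgn(2) disj' \<open>0 < t\<close> bound]
    have tB: "t * norm (signed_ind e \<eta> B) \<le> C * norm ?y"
      using pC[unfolded property_C_with_def, THEN conjunct2, rule_format, OF greedy(1) sgn(2)]
      by (simp only: greedy(2))
    have "norm (signed_ind e \<epsilon> A) \<le> D * norm (signed_ind e \<eta> B)"
      using sd fin le sgn unfolding superdemocratic_with_def by blast
    then have "t * norm (signed_ind e \<epsilon> A) \<le> D * (t * norm (signed_ind e \<eta> B))"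
      using \<open>0 < t\<close> by (simp add: mult.left_commute)
    also have "\<dots> \<le> D * (C * norm ?y)"
      using tB \<open>1 \<le> D\<close> by (intro mult_left_mono) auto
    finally have tA: "t * norm (signed_ind e \<epsilon> A) \<le> C * D * norm ?y"
      by (simp add: mult_ac)
    have "?z = ?y - t *\<^sub>R signed_ind e \<eta> B + t *\<^sub>R signed_ind e \<epsilon> A"
      by simp
    then have "norm ?z \<le> norm ?y + t * norm (signed_ind e \<eta> B) + t * norm (signed_ind e \<epsilon> A)"
      using norm_triangle_ineq[of "?y - t *\<^sub>R signed_ind e \<eta> B" "t *\<^sub>R signed_ind e \<epsilon> A"]
        norm_triangle_ineq4[of ?y "t *\<^sub>R signed_ind e \<eta> B"] \<open>0 < t\<close>
      by simp
    also have "\<dots> \<le> 1 * norm ?y + C * norm ?y + C * D * norm ?y"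
      using tA tB by simp
    also have "\<dots> \<le> C * D * norm ?y + C * D * norm ?y + C * D * norm ?y"
      using CD by (intro add_mono mult_right_mono[OF _ norm_ge_zero]) auto
    finally show ?thesis
      by simp
  qed
  moreover have "1 \<le> 3 * C * D"
    using CD(1) by simp
  ultimately show ?thesis
    unfolding property_A_with_def by blast
qed

theorem proposition4p2:
  fixes e :: "nat \<Rightarrow> 'a::banach" and e' :: "nat \<Rightarrow> 'a \<Rightarrow>\<^sub>L real" and w :: "nat \<Rightarrow> real"
  assumes "is_basis e e'"
    and "is_weight w"
    and "superdemocratic e w"
    and "property_C e e'"
  shows "property_A e e' w \<and>
    property_A_const e e' w \<le> 3 * property_C_const e e' * superdemocracy_const e w"
proof -
  have bi: "biorthogonal e e'"
    using assms(1) by (simp add: is_basis_def)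
  obtain D C where "superdemocratic_with e w D" "property_C_with e e' C"
    using assms(3,4) by (auto simp: superdemocratic_def property_C_def)
  have "superdemocratic_with e w (superdemocracy_const e w)"
    unfolding superdemocracy_const_def
    by (rule LEAST_real_closed(1)[where b = 1, OF closed_superdemocratic_with _ \<open>superdemocratic_with e w D\<close>])
      (simp add: superdemocratic_with_def)
  moreover have "property_C_with e e' (property_C_const e e')"
    unfolding property_C_const_def
    by (rule LEAST_real_closed(1)[OF closed_property_C_with[OF bi] property_C_with_ge_1[OF bi]
          \<open>property_C_with e e' C\<close>])
  ultimately have A: "property_A_with e e' w (3 * property_C_const e e' * superdemocracy_const e w)"
    by (rule property_A_with_superdemocratic_property_C[OF assms(1,2)])
  then have "property_A_const e e' w \<le> 3 * property_C_const e e' * superdemocracy_const e w"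
    unfolding property_A_const_def
    by (intro LEAST_real_closed(2)[where b = 1, OF closed_property_A_with]) (auto simp: property_A_with_def)
  with A show ?thesis
    by (auto simp: property_A_def)
qed

end
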